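(* There exists a deterministic online algorithm for the $2$-Canadian Traveller Problem with predictions (i.e. $k=2$) such that $ALG\le\frac{3+\sqrt{17}}{2}\,OPT$ on every instance whose prediction error is at most $1$.
   Context: $k$-Canadian Traveller Problem ($k$-CTP) with predictions: an instance consists of a connected undirected graph $G=(V,E)$, a source $s$, a destination $t$, a nonnegative cost function $c:E\to\mathbb{R}^+$, an unknown set $B\subseteq E$ of blocked edges with $|B|\le k$ such that $G-B$ contains an $s$-$t$ path, and a predicted set $B_p\subseteq E$ of blocked edges with $|B_p|\le k$. The traveller knows $G,c,s,t,k,B_p$ in advance, starts at $s$, and learns whether an edge is blocked only upon reaching one of its endpoints; blocked edges cannot be traversed. $ALG$ is the total cost travelled, $OPT$ the cost of a shortest $s$-$t$ path in $G-B$. The prediction error is $|B\triangle B_p|$. *)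

theory Defs
  imports Complex_Main
begin

text \<open>Finite simple undirected graphs: an edge is the two-element set of its endpoints.\<close>

definition simple_graph :: "'v set \<Rightarrow> 'v set set \<Rightarrow> bool" where
  "simple_graph V E \<longleftrightarrow> finite V \<and> (\<forall>e\<in>E. e \<subseteq> V \<and> card e = 2)"

fun walk_edges :: "'v list \<Rightarrow> 'v set list" where
  "walk_edges [] = []"
| "walk_edges [v] = []"
| "walk_edges (u # v # p) = {u, v} # walk_edges (v # p)"

definition walk_between :: "'v set \<Rightarrow> 'v set set \<Rightarrow> 'v \<Rightarrow> 'v \<Rightarrow> 'v list \<Rightarrow> bool" where
  "walk_between V E u v p \<longleftrightarrow>
     p \<noteq> [] \<and> set p \<subseteq> V \<and> set (walk_edges p) \<subseteq> E \<and> hd p = u \<and> last p = v"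

definition path_between :: "'v set \<Rightarrow> 'v set set \<Rightarrow> 'v \<Rightarrow> 'v \<Rightarrow> 'v list \<Rightarrow> bool" where
  "path_between V E u v p \<longleftrightarrow> walk_between V E u v p \<and> distinct p"

definition connected_graph :: "'v set \<Rightarrow> 'v set set \<Rightarrow> bool" where
  "connected_graph V E \<longleftrightarrow> (\<forall>u\<in>V. \<forall>v\<in>V. \<exists>p. path_between V E u v p)"

definition walk_cost :: "('v set \<Rightarrow> real) \<Rightarrow> 'v list \<Rightarrow> real" where
  "walk_cost c p = sum_list (map c (walk_edges p))"

text \<open>The part of an instance that the traveller knows in advance. The bound \<open>k\<close> on the
  number of blocked edges is a parameter of the problem, see \<open>ctp_instance\<close>.\<close>

record 'v ctp_input =
  verts :: "'v set"
  edges :: "'v set set"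
  cost :: "'v set \<Rightarrow> real"
  source :: 'v
  dest :: 'v
  predicted :: "'v set set"

definition ctp_instance :: "nat \<Rightarrow> 'v ctp_input \<Rightarrow> 'v set set \<Rightarrow> bool" where
  "ctp_instance k I B \<longleftrightarrow>
     simple_graph (verts I) (edges I) \<and> connected_graph (verts I) (edges I) \<and>
     source I \<in> verts I \<and> dest I \<in> verts I \<and>
     (\<forall>e\<in>edges I. 0 \<le> cost I e) \<and>
     predicted I \<subseteq> edges I \<and> card (predicted I) \<le> k \<and>
     B \<subseteq> edges I \<and> card B \<le> k \<and>
     (\<exists>p. path_between (verts I) (edges I - B) (source I) (dest I) p)"

definition prediction_error :: "'v ctp_input \<Rightarrow> 'v set set \<Rightarrow> nat" where
  "prediction_error I B = card ((B - predicted I) \<union> (predicted I - B))"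

text \<open>A deterministic online strategy chooses the next vertex from the known input and the
  history so far: the vertices visited, in order, each with the set of blocked edges incident
  to it. This is all that it learns about the set \<open>B\<close> of blocked edges.\<close>

type_synonym 'v ctp_history = "('v \<times> 'v set set) list"

type_synonym 'v ctp_strategy = "'v ctp_input \<Rightarrow> 'v ctp_history \<Rightarrow> 'v"

definition observed :: "'v set set \<Rightarrow> 'v list \<Rightarrow> 'v ctp_history" where
  "observed B p = map (\<lambda>v. (v, {e \<in> B. v \<in> e})) p"

text \<open>The complete route travelled: every move crosses an unblocked edge and is the one
  dictated by the strategy, and the traveller stops on first reaching the destination.\<close>

definition ctp_route :: "'v ctp_strategy \<Rightarrow> 'v ctp_input \<Rightarrow> 'v set set \<Rightarrow> 'v list \<Rightarrow> bool" where
  "ctp_route A I B p \<longleftrightarrow>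
     walk_between (verts I) (edges I - B) (source I) (dest I) p \<and>
     dest I \<notin> set (butlast p) \<and>
     (\<forall>i. Suc i < length p \<longrightarrow> p ! Suc i = A I (observed B (take (Suc i) p)))"

text \<open>Correctness of a strategy for the \<open>k\<close>-Canadian Traveller Problem with predictions:
  it reaches the destination on every instance, whatever the prediction error.\<close>

definition ctp_algorithm :: "nat \<Rightarrow> 'v ctp_strategy \<Rightarrow> bool" where
  "ctp_algorithm k A \<longleftrightarrow> (\<forall>I B. ctp_instance k I B \<longrightarrow> (\<exists>p. ctp_route A I B p))"

text \<open>Meaningful only if the strategy reaches the destination; the route is then unique by
  \<open>ctp_route_unique\<close> below.\<close>

definition ALG :: "'v ctp_strategy \<Rightarrow> 'v ctp_input \<Rightarrow> 'v set set \<Rightarrow> real" where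
  "ALG A I B = walk_cost (cost I) (THE p. ctp_route A I B p)"

definition OPT :: "'v ctp_input \<Rightarrow> 'v set set \<Rightarrow> real" where
  "OPT I B = Min (walk_cost (cost I) `
     {p. path_between (verts I) (edges I - B) (source I) (dest I) p})"

lemma ctp_route_unique:
  assumes p: "ctp_route A I B p" and q: "ctp_route A I B q"
  shows "p = q"
proof -
  have ne: "p \<noteq> []" "q \<noteq> []"
    and hd: "hd p = hd q"
    and last: "last p = dest I" "last q = dest I"
    and stop: "dest I \<notin> set (butlast p)" "dest I \<notin> set (butlast q)"
    using p q by (auto simp: ctp_route_def walk_between_def)
  have stepp: "p ! Suc i = A I (observed B (take (Suc i) p))" if "Suc i < length p" for i
    using p that by (auto simp: ctp_route_def)
  have stepq: "q ! Suc i = A I (observed B (take (Suc i) q))" if "Suc i < length q" for i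
    using q that by (auto simp: ctp_route_def)
  have pre: "take n p = take n q" if "n \<le> length p" "n \<le> length q" for n
    using that
  proof (induction n)
    case (Suc n)
    then have IH: "take n p = take n q" by simp
    have "p ! n = q ! n"
    proof (cases n)
      case 0
      then show ?thesis using ne hd by (simp add: hd_conv_nth)
    next
      case (Suc m)
      then show ?thesis using stepp[of m] stepq[of m] IH Suc.prems by simp
    qed
    then show ?case using IH Suc.prems by (simp add: take_Suc_conv_app_nth)
  qed simp
  have not_less: "\<not> length x < length y"
    if xy: "take (length x) x = take (length x) y" and "x \<noteq> []" "last x = dest I"
      "dest I \<notin> set (butlast y)" for x y :: "'a list"
  proof
    assume less: "length x < length y"
    have "dest I \<in> set x" using that(2,3) last_in_set by metis
    also have "set x = set (take (length x) (butlast y))"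
      using xy less by (simp add: take_butlast)
    finally show False using that(4) by (meson in_set_takeD)
  qed
  have "length p = length q"
    using not_less[of p q] not_less[of q p] pre[of "length p"] pre[of "length q"] ne last stop
    by (metis linorder_neq_iff order.strict_implies_order order_refl)
  then show ?thesis using pre[of "length p"] by simp
qed

lemma finite_paths:
  assumes "finite V"
  shows "finite {p. path_between V E u v p}"
proof (rule finite_subset)
  show "{p. path_between V E u v p} \<subseteq> {p. set p \<subseteq> V \<and> length p \<le> card V}"
    using assms by (auto simp: path_between_def walk_between_def)
      (metis card_mono distinct_card)
  show "finite {p. set p \<subseteq> V \<and> length p \<le> card V}"
    using assms by (rule finite_lists_length_le)
qed

end

theory Submission
  imports Defs
begin

text \<open>A plan assigns to the set \<open>K\<close> of edges known to be blocked a set \<open>\<sigma> K \<supseteq> K\<close> of edges to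
  avoid. Whenever the traveller is at the source, he sets out along a shortest path avoiding
  \<open>\<sigma> K\<close>, and he returns as soon as he sees that this path is blocked. Write \<open>d X\<close> for the length of
  a shortest path avoiding \<open>X\<close> and \<open>r = (3 + sqrt 17) / 2\<close>, so that \<open>r\<^sup>2 = 3 r + 2\<close>.

  If the prediction is \<open>P = {e}\<close>, trust it at once when \<open>d P \<le> r d {}\<close>. Otherwise try the path of
  length \<open>d {}\<close> first; the worst case is \<open>2 d {} + 2 d P + d B \<le> (3 + 2 / r) d B = r d B\<close>.

  If \<open>P = {a, b}\<close> with \<open>d {a} \<le> d {b}\<close>, only \<open>{a}\<close>, \<open>{b}\<close> and \<open>P\<close> are compatible with an error of
  at most \<open>1\<close>. Start with the path avoiding \<open>a\<close>. After its failure either avoid \<open>P\<close>, which is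
  good if \<open>2 d {a} + d P \<le> r d {b}\<close>, or try the path avoiding \<open>b\<close> before, which is good if
  \<open>2 d {a} + 2 d {b} + d P \<le> r d P\<close>. If both inequalities failed, eliminating \<open>d P\<close> would give
  \<open>(r\<^sup>2 - r - 2) d {b} < 2 r d {a}\<close>, that is \<open>d {b} < d {a}\<close>.\<close>

section \<open>Plans\<close>

text \<open>\<open>C\<close> is a possible cost bound for a traveller who is at the source and knows \<open>K\<close>. In
  \<open>retry\<close> he comes back knowing \<open>K'\<close>, which contains a blocked edge of the path he tried.\<close>

inductive trip :: "('e set \<Rightarrow> real) \<Rightarrow> ('e set \<Rightarrow> 'e set) \<Rightarrow> 'e set \<Rightarrow> 'e set \<Rightarrow> real \<Rightarrow> bool"
  for d \<sigma> B where
  arrive: "trip d \<sigma> B K (d (\<sigma> K))"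
| retry: "\<lbrakk>K \<subseteq> K'; K' \<subseteq> B; \<not> K' \<subseteq> \<sigma> K; trip d \<sigma> B K' C\<rbrakk> \<Longrightarrow> trip d \<sigma> B K (2 * d (\<sigma> K) + C)"

text \<open>A retry needs a blocked edge outside \<open>\<sigma> K\<close>, and
  \<open>B \<subseteq> \<sigma> K\<close> leaves none.\<close>

lemma trip_direct:
  assumes "trip d \<sigma> B K C" and "B \<subseteq> \<sigma> K"
  shows "C = d (\<sigma> K)"
  using assms(1)
proof cases
  case (retry K' C')
  then show ?thesis using assms(2) by blast
qed

lemma trip_le:
  assumes "trip d \<sigma> B K C" and "d (\<sigma> K) \<le> x"
    and "\<And>K' C'. \<lbrakk>K \<subseteq> K'; K' \<subseteq> B; \<not> K' \<subseteq> \<sigma> K; trip d \<sigma> B K' C'\<rbrakk> \<Longrightarrow> 2 * d (\<sigma> K) + C' \<le> x"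
  shows "C \<le> x"
  using assms(1)
proof cases
  case arrive
  then show ?thesis using assms(2) by simp
next
  case (retry K' C')
  then show ?thesis using assms(3) by blast
qed

lemma ratio_root:
  defines "r \<equiv> (3 + sqrt 17) / 2"
  shows "r * r = 3 * r + 2" and "3 \<le> r"
proof -
  have "sqrt 17 * sqrt 17 = 17" by simp
  then show "r * r = 3 * r + 2" unfolding r_def by (simp add: field_simps)
  show "3 \<le> r" unfolding r_def using real_le_rsqrt[of 3 17] by simp
qed

text \<open>Here \<open>d\<close> and \<open>feas\<close> abstract \<open>OPT\<close> and the
  existence of a path. Preserving \<open>feas\<close> serves correctness under any prediction error:
  a path to try always exists. The cost bound ranges over all \<open>K \<subseteq> B\<close> because
  the blocked edges at the source are known before the first move.\<close>

definition competitive_plan ::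
  "real \<Rightarrow> ('e set \<Rightarrow> real) \<Rightarrow> ('e set \<Rightarrow> bool) \<Rightarrow> 'e set \<Rightarrow> ('e set \<Rightarrow> 'e set) \<Rightarrow> bool" where
  "competitive_plan r d feas P \<sigma> \<longleftrightarrow>
     (\<forall>K. K \<subseteq> \<sigma> K \<and> (feas K \<longrightarrow> feas (\<sigma> K))) \<and>
     (\<forall>B K C. feas B \<and> finite B \<and> card B \<le> 2 \<and> card ((B - P) \<union> (P - B)) \<le> 1 \<and> K \<subseteq> B \<and>
        trip d \<sigma> B K C \<longrightarrow> C \<le> r * d B)"

lemma competitive_planD:
  assumes "competitive_plan r d feas P \<sigma>"
  shows "K \<subseteq> \<sigma> K" and "feas K \<Longrightarrow> feas (\<sigma> K)"
    and "\<lbrakk>feas B; finite B; card B \<le> 2; card ((B - P) \<union> (P - B)) \<le> 1; K \<subseteq> B; trip d \<sigma> B K C\<rbrakk>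
      \<Longrightarrow> C \<le> r * d B"
  using assms unfolding competitive_plan_def by simp_all

section \<open>Plans for an abstract distance that grows with the avoided set\<close>

context
  fixes d :: "'e set \<Rightarrow> real" and feas :: "'e set \<Rightarrow> bool" and r :: real
  assumes feas_antimono: "\<And>X Y. X \<subseteq> Y \<Longrightarrow> feas Y \<Longrightarrow> feas X"
    and d_nonneg: "\<And>X. feas X \<Longrightarrow> 0 \<le> d X"
    and d_mono: "\<And>X Y. X \<subseteq> Y \<Longrightarrow> feas Y \<Longrightarrow> d X \<le> d Y"
    and r_root: "r * r = 3 * r + 2" and r_ge: "3 \<le> r"
begin

lemma le_ratio: "x \<le> 3 * d B \<Longrightarrow> feas B \<Longrightarrow> x \<le> r * d B"
  using mult_right_mono[OF r_ge d_nonneg[of B]] by linarith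

text \<open>Falling back to \<open>K\<close> wherever \<open>\<sigma> K\<close> is infeasible makes
  the preservation of \<open>feas\<close> automatic, so only the cost bound is left to check for a
  concrete plan.\<close>

lemma competitive_planI:
  assumes "\<And>K. K \<subseteq> \<sigma> K"
    and "\<And>B K C. \<lbrakk>feas B; finite B; card B \<le> 2; card ((B - P) \<union> (P - B)) \<le> 1; K \<subseteq> B;
       trip d (\<lambda>K. if feas (\<sigma> K) then \<sigma> K else K) B K C\<rbrakk> \<Longrightarrow> C \<le> r * d B"
  shows "\<exists>\<sigma>. competitive_plan r d feas P \<sigma>"
  unfolding competitive_plan_def
  using assms by (intro exI[of _ "\<lambda>K. if feas (\<sigma> K) then \<sigma> K else K"] conjI allI impI) auto

lemma sym_diff_cases:
  assumes "finite B" "finite P" "card ((B - P) \<union> (P - B)) \<le> 1"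
  shows "B = P \<or> (\<exists>e\<in>P. B = P - {e}) \<or> (\<exists>f. f \<notin> P \<and> B = insert f P)"
proof -
  let ?D = "(B - P) \<union> (P - B)"
  have "finite ?D" using assms by simp
  then have "?D = {} \<or> (\<exists>x. ?D = {x})"
    using assms(3) card_1_singleton_iff[of ?D] by (metis One_nat_def card_0_eq le_0_eq le_SucE)
  then show ?thesis
  proof
    assume "?D = {}" then show ?thesis by auto
  next
    assume "\<exists>x. ?D = {x}"
    then obtain x where D: "?D = {x}" by blast
    have D': "(y \<in> B) \<noteq> (y \<in> P) \<longleftrightarrow> y = x" for y
    proof -
      have "y \<in> ?D \<longleftrightarrow> y = x" unfolding D by simp
      then show ?thesis by blast
    qed
    show ?thesis
    proof (cases "x \<in> P")
      case True
      have "y \<in> B \<longleftrightarrow> y \<in> P - {x}" for y using D'[of y] True by auto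
      then have "B = P - {x}" by (rule set_eqI)
      then show ?thesis using True by blast
    next
      case False
      have "y \<in> B \<longleftrightarrow> y \<in> insert x P" for y using D'[of y] False by auto
      then have "B = insert x P" by (rule set_eqI)
      then show ?thesis using False by blast
    qed
  qed
qed

text \<open>One missing predicted edge uses up the whole error, so no unpredicted edge is blocked,
  and a prediction of at most one edge has no other edge to offer.\<close>

lemma sym_diff_singleton:
  assumes "finite B" "finite P" "card P \<le> 1" "card ((B - P) \<union> (P - B)) \<le> 1" "\<not> P \<subseteq> B"
  shows "B = {}"
proof -
  obtain e where e: "e \<in> P" "B = P - {e}" using sym_diff_cases[OF assms(1,2,4)] assms(5) by blast
  have "x = e" if "x \<in> P" for x
    using card_le_Suc0_iff_eq[OF assms(2)] assms(3) e(1) that by simp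
  then show ?thesis using e(2) by auto
qed

text \<open>Only \<open>f\<close> can block a path that avoids \<open>K \<union> P\<close>. If it
  does, \<open>f\<close> was not in \<open>K\<close>, so \<open>K \<union> P = P\<close> and the
  failure is charged \<open>2 * d P\<close>. Afterwards the avoided set is exactly \<open>B\<close>,
  and the next attempt succeeds.\<close>

lemma trip_predicted_subset:
  assumes B: "feas B" and "P \<subseteq> B" "B \<subseteq> insert f P" and K: "K \<subseteq> B" "\<sigma> K = K \<union> P"
    and \<sigma>: "\<And>K'. K \<subseteq> K' \<Longrightarrow> K' \<subseteq> B \<Longrightarrow> \<not> K' \<subseteq> \<sigma> K \<Longrightarrow> \<sigma> K' = K' \<union> P"
    and "trip d \<sigma> B K C"
  shows "C \<le> 2 * d P + d B"
proof (rule trip_le[OF assms(7)])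
  have P: "0 \<le> d P" using d_nonneg feas_antimono assms by blast
  have "d (\<sigma> K) \<le> d B" using d_mono B assms(2) K by simp
  then show "d (\<sigma> K) \<le> 2 * d P + d B" using P by linarith
  fix K' C' assume K': "K \<subseteq> K'" "K' \<subseteq> B" "\<not> K' \<subseteq> \<sigma> K" and t: "trip d \<sigma> B K' C'"
  have f: "f \<in> K'" "f \<notin> K" using K' assms(3,5) by auto
  have "K' \<union> P = B" using f(1) K'(2) assms(2,3) by blast
  then have "\<sigma> K' = B" using \<sigma> K' by simp
  moreover have "K \<union> P = P" using f(2) K(1) assms(3) by blast
  then have "\<sigma> K = P" using K(2) by simp
  ultimately show "2 * d (\<sigma> K) + C' \<le> 2 * d P + d B" using trip_direct[OF t] by simp
qed

lemma plan_short_prediction: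
  assumes P: "finite P" "card P \<le> 1"
  shows "\<exists>\<sigma>. competitive_plan r d feas P \<sigma>"
proof (cases "feas P \<and> d P \<le> r * d {}")
  case True
  show ?thesis
  proof (rule competitive_planI[of "\<lambda>K. K \<union> P"])
    fix B K C
    let ?\<sigma> = "\<lambda>K. if feas (K \<union> P) then K \<union> P else K"
    assume B: "feas B" "finite B" "card ((B - P) \<union> (P - B)) \<le> 1" and K: "K \<subseteq> B"
      and t: "trip d ?\<sigma> B K C"
    show "C \<le> r * d B"
    proof (cases "P \<subseteq> B")
      case PB: True
      have \<sigma>: "?\<sigma> K' = K' \<union> P" if "K' \<subseteq> B" for K'
        using feas_antimono[of "K' \<union> P" B] B(1) that PB by simp
      obtain f where "B \<subseteq> insert f P" using sym_diff_cases[OF B(2) P(1) B(3)] by blast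
      then have "C \<le> 2 * d P + d B"
        using trip_predicted_subset[of B P f K ?\<sigma> C] B PB K \<sigma> t by blast
      then show ?thesis using d_mono[OF PB B(1)] B(1) le_ratio by force
    next
      case False
      then have "B = {}" using sym_diff_singleton[OF B(2) assms B(3)] by blast
      then have "K = {}" using K by simp
      then have "C = d P" using trip_direct[OF t] True \<open>B = {}\<close> by simp
      then show ?thesis using True \<open>B = {}\<close> by simp
    qed
  qed simp
next
  case False
  show ?thesis
  \<comment> \<open>Any known blocked edge shows \<open>B \<noteq> {}\<close>, hence
    \<open>P \<subseteq> B\<close> by \<open>sym_diff_singleton\<close>: from then on the prediction
    is certain and avoiding it is safe.\<close>
  proof (rule competitive_planI[of "\<lambda>K. if K = {} then {} else K \<union> P"])
    fix B K C
    let ?\<rho> = "\<lambda>K. if K = {} then {} else K \<union> P"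
    let ?\<sigma> = "\<lambda>K. if feas (?\<rho> K) then ?\<rho> K else K"
    assume B: "feas B" "finite B" "card ((B - P) \<union> (P - B)) \<le> 1" and K: "K \<subseteq> B"
      and t: "trip d ?\<sigma> B K C"
    have empty: "?\<sigma> {} = {}" by simp
    have d0: "0 \<le> d {}" "d {} \<le> d B" using d_nonneg d_mono feas_antimono B(1) by blast+
    show "C \<le> r * d B"
    proof (cases "P \<subseteq> B")
      case PB: True
      have \<sigma>: "?\<sigma> K' = K' \<union> P" if "K' \<subseteq> B" "K' \<noteq> {}" for K'
        using feas_antimono[of "K' \<union> P" B] B(1) that PB by simp
      have P: "feas P" "d P \<le> d B" "r * d {} < d P"
        using False feas_antimono d_mono PB B(1) by auto
      obtain f where f: "B \<subseteq> insert f P" using sym_diff_cases[OF B(2) assms(1) B(3)] by blast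
      have bound: "C' \<le> 2 * d P + d B" if "K' \<subseteq> B" "K' \<noteq> {}" "trip d ?\<sigma> B K' C'" for K' C'
        by (rule trip_predicted_subset[OF B(1) PB f that(1) \<sigma>[OF that(1,2)] _ that(3)])
          (use \<sigma> that in blast)
      show ?thesis
      proof (cases "K = {}")
        case True
        show ?thesis
        proof (rule trip_le[OF t])
          show "d (?\<sigma> K) \<le> r * d B" using True d0 le_ratio[OF _ B(1)] by simp
          fix K' C' assume K': "K \<subseteq> K'" "K' \<subseteq> B" "\<not> K' \<subseteq> ?\<sigma> K" "trip d ?\<sigma> B K' C'"
          then have "C' \<le> 2 * d P + d B" using bound empty by auto
          moreover have "2 * d {} + 2 * d P + d B \<le> r * d B"
          proof -
            \<comment> \<open>Multiplying by \<open>r\<close> brings in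
              \<open>r * d {} < d P \<le> d B\<close>, the failed test for trusting the prediction.
              The coefficients of \<open>d B\<close> then add up to \<open>3 * r + 2\<close>, which
              is \<open>r * r\<close>.\<close>
            have "r * (2 * d {} + 2 * d P + d B) = 2 * (r * d {}) + 2 * r * d P + r * d B"
              by (simp add: algebra_simps)
            also have "\<dots> \<le> 2 * d B + 2 * r * d B + r * d B"
              using P r_ge by (intro add_mono mult_left_mono) auto
            also have "\<dots> = (r * r) * d B" unfolding r_root by (simp add: algebra_simps)
            also have "\<dots> = r * (r * d B)" by (rule mult.assoc)
            finally show ?thesis using r_ge by simp
          qed
          ultimately show "2 * d (?\<sigma> K) + C' \<le> r * d B" using True empty by simp
        qed
      next
        case False
        then show ?thesis using bound[OF K False t] P(2) le_ratio B(1) by force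
      qed
    next
      case False
      then have "B = {}" using sym_diff_singleton[OF B(2) assms B(3)] by blast
      then have "C = d {}" using trip_direct[OF t] K by simp
      then show ?thesis using d0 le_ratio[OF _ B(1)] by simp
    qed
  qed simp
qed

section \<open>Predictions of two edges\<close>

lemma plan_two_ordered:
  assumes ne: "a \<noteq> b" and fa: "feas {a}" and ab: "feas {b} \<Longrightarrow> d {a} \<le> d {b}"
  shows "\<exists>\<sigma>. competitive_plan r d feas {a, b} \<sigma>"
proof -
  let ?P = "{a, b}"
  have two_cases: "B \<in> {{a, b}, {a}, {b}}"
    if "finite B" "card B \<le> 2" "card ((B - ?P) \<union> (?P - B)) \<le> 1" for B
    using sym_diff_cases[OF that(1) _ that(3)] that(2) ne by auto
  have fP: "feas {b} \<and> d {a} \<le> d ?P \<and> d {b} \<le> d ?P \<and> 0 \<le> d ?P" if "feas ?P"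
    using that by (intro conjI feas_antimono[of "{b}" ?P] d_mono d_nonneg) auto
  have da: "0 \<le> d {a}" using d_nonneg fa by blast
  show ?thesis
  \<comment> \<open>An infeasible \<open>?P\<close> falls under the second plan. If
    \<open>{b}\<close> is infeasible as well, \<open>B = {a}\<close> is the only feasible
    possibility, so the order of the distances matters only under \<open>feas {b}\<close>.\<close>
  proof (cases "feas ?P \<and> 2 * d {a} + d ?P \<le> r * d {b}")
    case True
    \<comment> \<open>Every admissible \<open>B\<close> lies in \<open>?P\<close>, so only
      \<open>b\<close> can block a path avoiding \<open>a\<close>. Once \<open>b\<close> is known,
      both edges are avoided and no further failure is possible.\<close>
    let ?\<rho> = "\<lambda>K. if b \<in> K then K \<union> ?P else insert a K"
    show ?thesis
    proof (rule competitive_planI[of ?\<rho>])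
      fix B K C
      let ?\<sigma> = "\<lambda>K. if feas (?\<rho> K) then ?\<rho> K else K"
      assume B: "feas B" "finite B" "card B \<le> 2" "card ((B - ?P) \<union> (?P - B)) \<le> 1"
        and K: "K \<subseteq> B" and t: "trip d ?\<sigma> B K C"
      note cases = two_cases[OF B(2-4)]
      have \<sigma>b: "?\<sigma> K' = ?P" if "b \<in> K'" "K' \<subseteq> B" for K'
      proof -
        have "?\<rho> K' = ?P" using that cases by auto
        then show ?thesis using True by simp
      qed
      have \<sigma>a: "?\<sigma> K' = {a}" if "b \<notin> K'" "K' \<subseteq> B" for K'
      proof -
        have "?\<rho> K' = {a}" using that cases by auto
        then show ?thesis using fa by simp
      qed
      have Cb: "C' = d ?P" if "b \<in> K'" "K' \<subseteq> B" "trip d ?\<sigma> B K' C'" for K' C'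
        using trip_direct[OF that(3)] \<sigma>b[OF that(1,2)] cases by auto
      have Ca: "C' \<le> (if b \<in> B then 2 * d {a} + d ?P else d {a})"
        if "b \<notin> K'" "K' \<subseteq> B" "trip d ?\<sigma> B K' C'" for K' C'
      proof (rule trip_le[OF that(3)])
        show "d (?\<sigma> K') \<le> (if b \<in> B then 2 * d {a} + d ?P else d {a})"
          unfolding \<sigma>a[OF that(1,2)] using True fP da by auto
        fix K'' C'' assume K'': "K'' \<subseteq> B" "\<not> K'' \<subseteq> ?\<sigma> K'" "trip d ?\<sigma> B K'' C''"
        then have "b \<in> K''" unfolding \<sigma>a[OF that(1,2)] using cases by auto
        then show "2 * d (?\<sigma> K') + C'' \<le> (if b \<in> B then 2 * d {a} + d ?P else d {a})"
          unfolding \<sigma>a[OF that(1,2)] using Cb K'' by auto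
      qed
      have "C \<le> (if b \<in> B then 2 * d {a} + d ?P else d {a})"
        using Ca[OF _ K t] Cb[OF _ K t] K da by fastforce
      moreover have "2 * d {a} + d ?P \<le> r * d ?P" using le_ratio[of _ ?P] True fP by auto
      moreover have "d {a} \<le> r * d {a}" using le_ratio[of _ "{a}"] fa da by auto
      ultimately show "C \<le> r * d B" using cases True ne by auto
    qed auto
  next
    case False
    \<comment> \<open>Once \<open>b\<close> is known, only known edges are avoided: unless
      \<open>a\<close> has been seen too, the path avoiding \<open>b\<close> alone gets its
      chance.\<close>
    let ?\<rho> = "\<lambda>K. if b \<in> K then K else insert a K"
    have key: "2 * d {a} + 2 * d {b} + d ?P \<le> r * d ?P" if "feas ?P"
    proof (rule ccontr)
      assume "\<not> ?thesis"
      then have 1: "(r - 1) * d ?P < 2 * d {a} + 2 * d {b}" by (simp add: algebra_simps)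
      have 2: "r * d {b} < 2 * d {a} + d ?P" using False that by simp
      \<comment> \<open>The factor \<open>r - 1\<close> is the coefficient of \<open>d ?P\<close> in
        \<open>1\<close>, so that \<open>d ?P\<close> can be eliminated between the two
        inequalities.\<close>
      have "(r - 1) * (r * d {b}) < (r - 1) * (2 * d {a} + d ?P)"
        using 2 r_ge by (intro mult_strict_left_mono) auto
      also have "\<dots> < (r - 1) * (2 * d {a}) + (2 * d {a} + 2 * d {b})"
        using 1 by (simp add: algebra_simps)
      finally have "(r * r) * d {b} < 2 * r * d {a} + r * d {b} + 2 * d {b}"
        by (simp add: algebra_simps)
      then have "r * d {b} < r * d {a}" unfolding r_root by (simp add: algebra_simps)
      then show False using ab fP[OF that] r_ge by simp
    qed
    show ?thesis
    proof (rule competitive_planI[of ?\<rho>])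
      fix B K C
      let ?\<sigma> = "\<lambda>K. if feas (?\<rho> K) then ?\<rho> K else K"
      assume B: "feas B" "finite B" "card B \<le> 2" "card ((B - ?P) \<union> (?P - B)) \<le> 1"
        and K: "K \<subseteq> B" and t: "trip d ?\<sigma> B K C"
      note cases = two_cases[OF B(2-4)]
      have \<sigma>b: "?\<sigma> K' = K'" if "b \<in> K'" for K' using that by simp
      have \<sigma>a: "?\<sigma> K' = {a}" if "b \<notin> K'" "K' \<subseteq> B" for K'
      proof -
        have "?\<rho> K' = {a}" using that cases by auto
        then show ?thesis using fa by simp
      qed
      have fb: "feas {b} \<and> 0 \<le> d {b} \<and> d {b} \<le> d B" if "b \<in> B"
        using that B(1) by (intro conjI feas_antimono[of "{b}" B] d_nonneg d_mono) auto
      \<comment> \<open>For \<open>b \<in> B\<close>, \<open>?x\<close> bounds the cost that remains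
        once \<open>b\<close> is known; the term \<open>2 * d {b}\<close> pays for one more failure,
        possible only if \<open>a\<close> is blocked too.\<close>
      let ?x = "if b \<in> B then if a \<in> B then 2 * d {b} + d B else d B else d {a}"
      have Cb: "C' \<le> ?x" if "b \<in> K'" "K' \<subseteq> B" "trip d ?\<sigma> B K' C'" for K' C'
      proof (rule trip_le[OF that(3)])
        have bB: "b \<in> B" using that by blast
        have "d K' \<le> d B" using d_mono B(1) that(2) by blast
        then show "d (?\<sigma> K') \<le> ?x"
          unfolding \<sigma>b[OF that(1)] using fb[OF bB] bB by auto
        fix K'' C'' assume K'': "K' \<subseteq> K''" "K'' \<subseteq> B" "\<not> K'' \<subseteq> ?\<sigma> K'" "trip d ?\<sigma> B K'' C''"
        have bK: "b \<in> K''" using K'' that by blast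
        have "\<not> K'' \<subseteq> K'" using K''(3) unfolding \<sigma>b[OF that(1)] .
        \<comment> \<open>As \<open>b\<close> is already in \<open>K'\<close>, the only edge that a
          new failure can reveal is \<open>a\<close>, and then all of \<open>B\<close> is
          known.\<close>
        then have "K' = {b}" "K'' = B" "a \<in> B" using that(1) K''(1,2) cases by auto
        moreover have "C'' = d K''"
          using trip_direct[OF K''(4)] unfolding \<sigma>b[OF bK] using \<open>K'' = B\<close> by simp
        ultimately show "2 * d (?\<sigma> K') + C'' \<le> ?x"
          unfolding \<sigma>b[OF that(1)] using bB by simp
      qed
      have dab: "d {a} \<le> d B" using cases ab B(1) d_mono[OF _ B(1), of "{a}"] by auto
      have Ca: "C' \<le> (if b \<in> B then 2 * d {a} + ?x else d {a})"
        if "b \<notin> K'" "K' \<subseteq> B" "trip d ?\<sigma> B K' C'" for K' C'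
      proof (rule trip_le[OF that(3)])
        show "d (?\<sigma> K') \<le> (if b \<in> B then 2 * d {a} + ?x else d {a})"
          unfolding \<sigma>a[OF that(1,2)] using dab da fb by auto
        fix K'' C'' assume K'': "K'' \<subseteq> B" "\<not> K'' \<subseteq> ?\<sigma> K'" "trip d ?\<sigma> B K'' C''"
        then have "b \<in> K''" unfolding \<sigma>a[OF that(1,2)] using cases by auto
        moreover then have "b \<in> B" using K'' by blast
        ultimately show "2 * d (?\<sigma> K') + C'' \<le> (if b \<in> B then 2 * d {a} + ?x else d {a})"
          unfolding \<sigma>a[OF that(1,2)] using Cb[OF _ K''(1) K''(3)] by simp
      qed
      have C: "C \<le> (if b \<in> B then 2 * d {a} + ?x else d {a})"
        using Ca[OF _ K t] Cb[OF _ K t] K da by (cases "b \<in> K") auto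
      consider "B = ?P" | "B = {a}" | "B = {b}" using cases by blast
      then show "C \<le> r * d B"
      proof cases
        case 1
        then have "C \<le> 2 * d {a} + 2 * d {b} + d ?P" using C by simp
        then show ?thesis using key B(1) 1 by simp
      next
        case 2
        then show ?thesis using C ne le_ratio[of _ B] B(1) da by simp
      next
        case 3
        then show ?thesis using C ne le_ratio[of _ B] B(1) ab by simp
      qed
    qed auto
  qed
qed

lemma competitive_plan_exists:
  assumes P: "finite P" "card P \<le> 2"
  shows "\<exists>\<sigma>. competitive_plan r d feas P \<sigma>"
proof (cases "card P \<le> 1")
  case True
  then show ?thesis using plan_short_prediction P by blast
next
  case False
  then obtain a b where ab: "P = {a, b}" "a \<noteq> b"
    using P by (metis card_2_iff nat_1_add_1 le_antisym not_less_eq_eq plus_1_eq_Suc)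
  consider "feas {a}" "feas {b} \<Longrightarrow> d {a} \<le> d {b}" | "feas {b}" "feas {a} \<Longrightarrow> d {b} \<le> d {a}"
    | "\<not> feas {a}" "\<not> feas {b}" by linarith
  then show ?thesis
  proof cases
    case 1
    then show ?thesis using plan_two_ordered ab by blast
  next
    case 2
    then show ?thesis using plan_two_ordered[of b a] ab by (simp add: insert_commute)
  next
    case 3
    \<comment> \<open>Each \<open>B\<close> within the error bound contains \<open>a\<close> or
      \<open>b\<close>, so the cost bound is vacuous, and avoiding just the known edges is a
      plan.\<close>
    have "\<not> feas B" if "finite B" "card B \<le> 2" "card ((B - P) \<union> (P - B)) \<le> 1" for B
    proof -
      have "{a} \<subseteq> B \<or> {b} \<subseteq> B" using sym_diff_cases[OF that(1) P(1) that(3)] ab by auto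
      then show ?thesis using 3 feas_antimono by blast
    qed
    then show ?thesis unfolding competitive_plan_def by (intro exI[of _ "\<lambda>K. K"]) blast
  qed
qed

end

section \<open>Walking along planned paths\<close>

lemma walk_edges_snoc:
  "p \<noteq> [] \<Longrightarrow> walk_edges (p @ [v]) = walk_edges p @ [{last p, v}]"
  by (induction p rule: walk_edges.induct) auto

lemma walk_cost_snoc:
  "p \<noteq> [] \<Longrightarrow> walk_cost c (p @ [v]) = walk_cost c p + c {last p, v}"
  by (simp add: walk_cost_def walk_edges_snoc)

lemma set_walk_edges: "set (walk_edges p) = {{p ! i, p ! Suc i} | i. Suc i < length p}"
proof (induction p rule: walk_edges.induct)
  case (3 u v p)
  have "{{(u # v # p) ! i, (u # v # p) ! Suc i} | i. Suc i < length (u # v # p)} =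
      insert {u, v} {{(v # p) ! i, (v # p) ! Suc i} | i. Suc i < length (v # p)}" (is "?L = ?R")
  proof
    show "?L \<subseteq> ?R"
    proof
      fix e assume "e \<in> ?L"
      then obtain i where "e = {(u # v # p) ! i, (u # v # p) ! Suc i}" "Suc i < length (u # v # p)"
        by blast
      then show "e \<in> ?R" by (cases i) auto
    qed
    show "?R \<subseteq> ?L"
    proof
      fix e assume "e \<in> ?R"
      then consider "e = {u, v}"
        | i where "e = {(v # p) ! i, (v # p) ! Suc i}" "Suc i < length (v # p)" by blast
      then show "e \<in> ?L"
      proof cases
        case 1
        then show ?thesis by (intro CollectI exI[of _ 0]) simp
      next
        case 2
        then show ?thesis by (intro CollectI exI[of _ "Suc i"]) simp
      qed
    qed
  qed
  then show ?case using 3 by simp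
qed auto

text \<open>With the cost indexed by positions, walking along a path up to position \<open>j\<close>
  costs a partial sum. Truncated subtraction makes the sum empty for \<open>p = []\<close>.\<close>

lemma walk_cost_sum: "walk_cost c p = (\<Sum>i<length p - 1. c {p ! i, p ! Suc i})"
proof (induction p rule: walk_edges.induct)
  case (3 u v p)
  then show ?case by (simp add: walk_cost_def sum.lessThan_Suc_shift del: sum.lessThan_Suc)
qed (auto simp: walk_cost_def)

section \<open>The strategy and its unfinished routes\<close>

definition known :: "'v ctp_history \<Rightarrow> 'v set set" where
  "known h = (\<Union>x\<in>set h. snd x)"

text \<open>What was known on the most recent visit to \<open>s\<close>. It determines the path being tried, so the
  strategy needs no memory besides the history.\<close>

definition known_at_home :: "'v \<Rightarrow> 'v ctp_history \<Rightarrow> 'v set set" where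
  "known_at_home s h = known (dropWhile (\<lambda>x. fst x \<noteq> s) (rev h))"

text \<open>On a path with distinct vertices the position of \<open>v\<close> is unique, so the
  description denotes its successor unless \<open>v\<close> comes last; \<open>pred_on\<close> is
  the mirror image.\<close>

definition succ_on :: "'v list \<Rightarrow> 'v \<Rightarrow> 'v" where
  "succ_on P v = (THE w. \<exists>i. Suc i < length P \<and> P ! i = v \<and> P ! Suc i = w)"

definition pred_on :: "'v list \<Rightarrow> 'v \<Rightarrow> 'v" where
  "pred_on P v = (THE w. \<exists>i. Suc i < length P \<and> P ! Suc i = v \<and> P ! i = w)"

text \<open>If each \<open>\<pi> K\<close> avoids \<open>K\<close>, a known blocked edge on
  \<open>P\<close> was discovered during the current excursion and is the signal to turn back.
  Reaching the source updates \<open>known_at_home\<close>; the new path is clear of known edges, so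
  the walk goes forward again.\<close>

definition follow :: "('v set set \<Rightarrow> 'v list) \<Rightarrow> 'v \<Rightarrow> 'v ctp_history \<Rightarrow> 'v" where
  "follow \<pi> s h =
     (let P = \<pi> (known_at_home s h); v = fst (last h)
      in if set (walk_edges P) \<inter> known h = {} then succ_on P v else pred_on P v)"

lemma known_observed: "known (observed B p) = {e \<in> B. \<exists>v\<in>set p. v \<in> e}"
  by (auto simp: known_def observed_def)

lemma known_observed_subset: "known (observed B p) \<subseteq> B"
  by (auto simp: known_observed)

lemma known_observed_snoc:
  "known (observed B (p @ [v])) = known (observed B p) \<union> {e \<in> B. v \<in> e}"
  by (auto simp: known_observed)

lemma known_at_home_last:
  "p \<noteq> [] \<Longrightarrow> last p = s \<Longrightarrow> known_at_home s (observed B p) = known (observed B p)"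
  by (cases p rule: rev_cases) (auto simp: known_at_home_def observed_def known_def)

lemma known_at_home_snoc:
  "v \<noteq> s \<Longrightarrow> known_at_home s (observed B (p @ [v])) = known_at_home s (observed B p)"
  by (simp add: known_at_home_def observed_def)

lemma fst_last_observed: "p \<noteq> [] \<Longrightarrow> fst (last (observed B p)) = last p"
  by (simp add: observed_def last_map)

lemma succ_on_nth:
  assumes "distinct P" "Suc i < length P"
  shows "succ_on P (P ! i) = P ! Suc i"
  unfolding succ_on_def
  by (rule the_equality) (use assms in \<open>auto simp: nth_eq_iff_index_eq\<close>)

lemma pred_on_nth:
  assumes "distinct P" "Suc i < length P"
  shows "pred_on P (P ! Suc i) = P ! i"
  unfolding pred_on_def
  by (rule the_equality) (use assms in \<open>auto simp: nth_eq_iff_index_eq\<close>)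

text \<open>The conditions of \<open>ctp_route\<close> without arrival at the destination, so that a
  route can be built vertex by vertex.\<close>

definition route_prefix :: "'v ctp_strategy \<Rightarrow> 'v ctp_input \<Rightarrow> 'v set set \<Rightarrow> 'v list \<Rightarrow> bool" where
  "route_prefix A I B p \<longleftrightarrow>
     p \<noteq> [] \<and> hd p = source I \<and> set p \<subseteq> verts I \<and> set (walk_edges p) \<subseteq> edges I - B \<and>
     dest I \<notin> set (butlast p) \<and>
     (\<forall>i. Suc i < length p \<longrightarrow> p ! Suc i = A I (observed B (take (Suc i) p)))"

lemma ctp_route_iff_prefix: "ctp_route A I B p \<longleftrightarrow> route_prefix A I B p \<and> last p = dest I"
  by (auto simp: ctp_route_def route_prefix_def walk_between_def)

lemma route_prefix_snoc:
  assumes p: "route_prefix A I B p" "last p \<noteq> dest I"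
    and v: "A I (observed B p) = v" "v \<in> verts I" "{last p, v} \<in> edges I - B"
  shows "route_prefix A I B (p @ [v])"
proof -
  have ne: "p \<noteq> []" using p by (simp add: route_prefix_def)
  have "dest I \<notin> set p"
    using p append_butlast_last_id[OF ne] unfolding route_prefix_def
    by (metis Un_iff empty_iff empty_set set_ConsD set_append)
  moreover have "(p @ [v]) ! Suc i = A I (observed B (take (Suc i) (p @ [v])))"
    if "Suc i < length (p @ [v])" for i
  proof (cases "Suc i < length p")
    case True
    then show ?thesis using p by (simp add: route_prefix_def nth_append)
  next
    case False
    then have "Suc i = length p" using that by simp
    then show ?thesis using v(1) by (simp add: nth_append)
  qed
  ultimately show ?thesis using p v ne by (auto simp: route_prefix_def walk_edges_snoc)
qed

section \<open>Excursions from the source\<close>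

context
  fixes A :: "'v ctp_strategy" and I :: "'v ctp_input" and B :: "'v set set"
    and \<pi> :: "'v set set \<Rightarrow> 'v list"
  assumes A: "\<And>h. A I h = follow \<pi> (source I) h"
    and cost_nonneg: "\<And>e. e \<in> edges I \<Longrightarrow> 0 \<le> cost I e"
    and \<pi>_path: "\<And>K. K \<subseteq> B \<Longrightarrow> path_between (verts I) (edges I - K) (source I) (dest I) (\<pi> K)"
begin

abbreviation sees :: "'v list \<Rightarrow> 'v set set" where
  "sees r \<equiv> known (observed B r)"

text \<open>The traveller walks along \<open>P\<close> to the first vertex incident to a blocked
  edge of \<open>P\<close>, and from there back over the edges just crossed. If there is no such
  vertex, he arrives.\<close>

lemma excursion:
  assumes p: "route_prefix A I B p" "last p = source I"
  defines "K \<equiv> sees p"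
  defines "P \<equiv> \<pi> K"
  shows "(\<exists>q. ctp_route A I B q \<and> walk_cost (cost I) q = walk_cost (cost I) p + walk_cost (cost I) P) \<or>
    (\<exists>q. route_prefix A I B q \<and> last q = source I \<and> K \<subseteq> sees q \<and>
      sees q \<inter> set (walk_edges P) \<noteq> {} \<and>
      walk_cost (cost I) q \<le> walk_cost (cost I) p + 2 * walk_cost (cost I) P)"
proof -
  let ?c = "walk_cost (cost I)" and ?s = "source I" and ?t = "dest I"
  let ?S = "\<lambda>i. \<Sum>k<i. cost I {P ! k, P ! Suc k}"
  let ?home = "\<lambda>r. known_at_home ?s (observed B r)"
  have KB: "K \<subseteq> B" unfolding K_def by (rule known_observed_subset)
  have P: "P \<noteq> []" "set P \<subseteq> verts I" "set (walk_edges P) \<subseteq> edges I - K" "distinct P"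
    "P ! 0 = ?s" "P ! (length P - 1) = ?t"
    using \<pi>_path[OF KB] unfolding P_def path_between_def walk_between_def
    by (auto simp: hd_conv_nth last_conv_nth)
  have edge: "{P ! i, P ! Suc i} \<in> set (walk_edges P)" if "Suc i < length P" for i
    using that unfolding set_walk_edges by blast
  have len: "0 < length P" using P(1) by simp
  have in_verts: "P ! i \<in> verts I" if "i < length P" for i
    using that P(2) nth_mem by blast
  have not_s: "P ! i \<noteq> ?s" if "0 < i" "i < length P" for i
    using that(1) P(5) nth_eq_iff_index_eq[OF P(4) that(2) len] by simp
  have not_t: "P ! i \<noteq> ?t" if "Suc i < length P" for i
    using that P(6) nth_eq_iff_index_eq[OF P(4) Suc_lessD[OF that], of "length P - 1"] len by simp
  \<comment> \<open>At a touched vertex the traveller learns of a blocked edge of \<open>P\<close>.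
    From an untouched one the next edge of \<open>P\<close> is free.\<close>
  define touched where "touched i \<longleftrightarrow> (\<exists>e\<in>B \<inter> set (walk_edges P). P ! i \<in> e)" for i
  have free: "{P ! i, P ! Suc i} \<in> edges I - B"
    if "Suc i < length P" "\<not> touched i" for i
    using edge[OF that(1)] that(2) P(3) unfolding touched_def by blast
  \<comment> \<open>The invariant keeps the knowledge at the last visit to the source equal to
    \<open>K\<close>, so the strategy still consults the same \<open>P\<close>.\<close>
  have forward: "\<exists>r. route_prefix A I B r \<and> last r = P ! j \<and> ?home r = K \<and> K \<subseteq> sees r \<and>
      (sees r \<inter> set (walk_edges P) = {} \<longleftrightarrow> \<not> touched j) \<and> ?c r = ?c p + ?S j"
    if "j < length P" "\<forall>i<j. \<not> touched i" for j
    using that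
  proof (induction j)
    case 0
    have ne: "p \<noteq> []" using p by (simp add: route_prefix_def)
    \<comment> \<open>All blocked edges at the source are in \<open>K\<close>, and \<open>P\<close>
      avoids \<open>K\<close>.\<close>
    have "\<not> touched 0"
    proof
      assume "touched 0"
      then obtain e where e: "e \<in> B" "e \<in> set (walk_edges P)" "?s \<in> e"
        unfolding touched_def P(5) by blast
      then have "e \<in> K" unfolding K_def known_observed using p(2) last_in_set[OF ne] by auto
      then show False using e P(3) by blast
    qed
    then show ?case
      using p P(3,5) known_at_home_last[OF ne p(2)] K_def by (intro exI[of _ p]) auto
  next
    case (Suc j)
    then obtain r where r: "route_prefix A I B r" "last r = P ! j" "?home r = K" "K \<subseteq> sees r"
      "sees r \<inter> set (walk_edges P) = {}" "?c r = ?c p + ?S j"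
      by auto
    have ne: "r \<noteq> []" using r by (simp add: route_prefix_def)
    have v: "A I (observed B r) = P ! Suc j"
      unfolding A follow_def Let_def r(3) P_def[symmetric] fst_last_observed[OF ne] r(2)
      using r(5) succ_on_nth[OF P(4)] Suc.prems(1) by (simp add: Int_commute)
    have "route_prefix A I B (r @ [P ! Suc j])"
      using route_prefix_snoc[OF r(1) _ v] r(2) not_t[OF Suc.prems(1)] free[OF Suc.prems(1)]
        Suc.prems in_verts[OF Suc.prems(1)] by simp
    moreover have "?home (r @ [P ! Suc j]) = K"
      using known_at_home_snoc[OF not_s[OF _ Suc.prems(1)]] r(3) by simp
    moreover have "sees (r @ [P ! Suc j]) \<inter> set (walk_edges P) = {} \<longleftrightarrow> \<not> touched (Suc j)"
      unfolding known_observed_snoc touched_def using r(5) by blast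
    ultimately show ?case
      using r(2,4,6) walk_cost_snoc[OF ne]
      by (intro exI[of _ "r @ [P ! Suc j]"]) (auto simp: known_observed_snoc)
  qed
  have c_nonneg: "0 \<le> cost I {P ! k, P ! Suc k}" if "Suc k < length P" for k
    using cost_nonneg edge[OF that] P(3) by blast
  show ?thesis
  proof (cases "\<exists>i. i < length P \<and> touched i")
    case False
    then obtain r where "route_prefix A I B r" "last r = P ! (length P - 1)"
        "?c r = ?c p + ?S (length P - 1)"
      using forward[of "length P - 1"] P(1) by auto
    then have "ctp_route A I B r \<and> ?c r = ?c p + ?c P"
      using P(6) walk_cost_sum[of "cost I" P] by (simp add: ctp_route_iff_prefix)
    then show ?thesis by blast
  next
    case True
    define j where "j = (LEAST i. i < length P \<and> touched i)"
    have j: "j < length P" "touched j"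
      using LeastI_ex[OF True] unfolding j_def by auto
    have below: "\<not> touched i" if "i < j" for i
      using not_less_Least[of i "\<lambda>i. i < length P \<and> touched i"] that j(1) unfolding j_def
      by linarith
    \<comment> \<open>The turning point precedes the destination: the near end \<open>k\<close> of a
      blocked edge of \<open>P\<close> is touched, so \<open>j \<le> k\<close>. The walk therefore
      does not meet the destination before turning back.\<close>
    obtain k where k: "Suc k < length P" "{P ! k, P ! Suc k} \<in> B"
      using j(2) unfolding touched_def set_walk_edges by blast
    have "touched k" using k edge unfolding touched_def by auto
    then have "\<not> k < j" using below by blast
    then have "Suc j < length P" using k(1) by linarith
    \<comment> \<open>Downward induction from \<open>j\<close> to the source. The distance out is
      \<open>?S j\<close> and the distance back so far is \<open>?S j - ?S i\<close>. The condition
      \<open>0 < i\<close> is there because arrival at the source replaces \<open>K\<close> by the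
      new knowledge.\<close>
    have backward: "\<exists>r. route_prefix A I B r \<and> last r = P ! i \<and> (0 < i \<longrightarrow> ?home r = K) \<and> K \<subseteq> sees r \<and>
        sees r \<inter> set (walk_edges P) \<noteq> {} \<and> ?c r + ?S i = ?c p + 2 * ?S j"
      if "i \<le> j" for i
      using that
    proof (induction rule: inc_induct)
      case base
      obtain r where "route_prefix A I B r" "last r = P ! j" "?home r = K" "K \<subseteq> sees r"
        "sees r \<inter> set (walk_edges P) \<noteq> {}" "?c r = ?c p + ?S j"
        using forward[OF j(1)] below j(2) by blast
      then show ?case by (intro exI[of _ r]) auto
    next
      case (step i)
      then obtain r where r: "route_prefix A I B r" "last r = P ! Suc i" "?home r = K"
        "K \<subseteq> sees r" "sees r \<inter> set (walk_edges P) \<noteq> {}" "?c r + ?S (Suc i) = ?c p + 2 * ?S j"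
        by auto
      have i: "Suc i < length P" "Suc (Suc i) < length P"
        using step(2) \<open>Suc j < length P\<close> by auto
      have ne: "r \<noteq> []" using r by (simp add: route_prefix_def)
      have v: "A I (observed B r) = P ! i"
        unfolding A follow_def Let_def r(3) P_def[symmetric] fst_last_observed[OF ne] r(2)
        using r(5) pred_on_nth[OF P(4) i(1)] by (simp add: Int_commute)
      have "route_prefix A I B (r @ [P ! i])"
        using route_prefix_snoc[OF r(1) _ v] r(2) not_t[OF i(2)] free[OF i(1) below[OF step(2)]]
          in_verts[OF Suc_lessD[OF i(1)]] by (simp add: insert_commute)
      moreover have "?home (r @ [P ! i]) = K" if "0 < i"
        using known_at_home_snoc[OF not_s[OF that]] i r(3) by simp
      moreover have "?c (r @ [P ! i]) + ?S i = ?c p + 2 * ?S j"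
        using r(2,6) walk_cost_snoc[OF ne] by (simp add: insert_commute)
      moreover have "K \<subseteq> sees (r @ [P ! i])" "sees (r @ [P ! i]) \<inter> set (walk_edges P) \<noteq> {}"
        using r(4,5) unfolding known_observed_snoc by blast+
      ultimately show ?case by (intro exI[of _ "r @ [P ! i]"]) simp
    qed
    have "?S j \<le> ?c P" unfolding walk_cost_sum
      using j(1) c_nonneg by (intro sum_mono2) auto
    then show ?thesis using backward[of 0] P(5) by fastforce
  qed
qed

text \<open>The tried path avoids all known blocked edges, so a failed excursion reveals a new one
  and the number of unseen blocked edges decreases. Arrival and failure match the two rules of
  \<open>trip\<close>; a failure also lies outside \<open>\<sigma> K\<close>, since the path avoids
  that set.\<close>

lemma route_exists:
  assumes B: "finite B" and d: "\<And>K. K \<subseteq> B \<Longrightarrow> walk_cost (cost I) (\<pi> K) = d (\<sigma> K)"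
    and \<sigma>: "\<And>K. K \<subseteq> B \<Longrightarrow> set (walk_edges (\<pi> K)) \<inter> \<sigma> K = {}"
    and p: "route_prefix A I B p" "last p = source I"
  shows "\<exists>q C. ctp_route A I B q \<and> trip d \<sigma> B (sees p) C \<and>
    walk_cost (cost I) q \<le> walk_cost (cost I) p + C"
  using p
proof (induction "card (B - sees p)" arbitrary: p rule: less_induct)
  case less
  have KB: "sees p \<subseteq> B" by (rule known_observed_subset)
  from excursion[OF less.prems] show ?case
  proof (elim disjE exE conjE)
    fix q assume "ctp_route A I B q"
      "walk_cost (cost I) q = walk_cost (cost I) p + walk_cost (cost I) (\<pi> (sees p))"
    then show ?thesis using d[OF KB] trip.arrive[of d \<sigma> B "sees p"]
      by (metis order_refl)
  next
    fix q assume q: "route_prefix A I B q" "last q = source I" "sees p \<subseteq> sees q"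
      "sees q \<inter> set (walk_edges (\<pi> (sees p))) \<noteq> {}"
      "walk_cost (cost I) q \<le> walk_cost (cost I) p + 2 * walk_cost (cost I) (\<pi> (sees p))"
    have "sees q \<subseteq> B" by (rule known_observed_subset)
    have "sees p \<inter> set (walk_edges (\<pi> (sees p))) = {}"
      using \<pi>_path[OF KB] unfolding path_between_def walk_between_def by blast
    then have "B - sees q \<subset> B - sees p" using q(3,4) \<open>sees q \<subseteq> B\<close> by blast
    then have "card (B - sees q) < card (B - sees p)" using B by (simp add: psubset_card_mono)
    from less.hyps[OF this q(1,2)] obtain q' C where
      q': "ctp_route A I B q'" "trip d \<sigma> B (sees q) C"
        "walk_cost (cost I) q' \<le> walk_cost (cost I) q + C" by blast
    have "\<not> sees q \<subseteq> \<sigma> (sees p)" using q(4) \<sigma>[OF KB] by blast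
    then have "trip d \<sigma> B (sees p) (2 * d (\<sigma> (sees p)) + C)"
      by (rule trip.retry[of _ _ _ _ d, OF q(3) \<open>sees q \<subseteq> B\<close> _ q'(2)])
    moreover have "walk_cost (cost I) q' \<le> walk_cost (cost I) p + (2 * d (\<sigma> (sees p)) + C)"
      using q'(3) q(5) d[OF KB] by linarith
    ultimately show ?thesis using q'(1) by blast
  qed
qed

end

section \<open>Shortest paths and the competitive ratio\<close>

definition feasible :: "'v ctp_input \<Rightarrow> 'v set set \<Rightarrow> bool" where
  "feasible I X \<longleftrightarrow> (\<exists>p. path_between (verts I) (edges I - X) (source I) (dest I) p)"

definition shortest_path :: "'v ctp_input \<Rightarrow> 'v set set \<Rightarrow> 'v list" where
  "shortest_path I X = (SOME p. path_between (verts I) (edges I - X) (source I) (dest I) p \<and>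
     walk_cost (cost I) p = OPT I X)"

lemma path_between_mono: "path_between V E u v p \<Longrightarrow> E \<subseteq> E' \<Longrightarrow> path_between V E' u v p"
  by (auto simp: path_between_def walk_between_def)

lemma feasible_antimono: "X \<subseteq> Y \<Longrightarrow> feasible I Y \<Longrightarrow> feasible I X"
  unfolding feasible_def by (meson Diff_mono order_refl path_between_mono)

lemma shortest_path:
  assumes "finite (verts I)" "feasible I X"
  shows "path_between (verts I) (edges I - X) (source I) (dest I) (shortest_path I X)"
    and "walk_cost (cost I) (shortest_path I X) = OPT I X"
proof -
  let ?S = "{p. path_between (verts I) (edges I - X) (source I) (dest I) p}"
  have "OPT I X \<in> walk_cost (cost I) ` ?S"
    unfolding OPT_def using assms finite_paths[OF assms(1)]
    by (intro Min_in) (auto simp: feasible_def)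
  then have "\<exists>p. path_between (verts I) (edges I - X) (source I) (dest I) p \<and>
      walk_cost (cost I) p = OPT I X" by auto
  from someI_ex[OF this]
  show "path_between (verts I) (edges I - X) (source I) (dest I) (shortest_path I X)"
    and "walk_cost (cost I) (shortest_path I X) = OPT I X"
    unfolding shortest_path_def by auto
qed

lemma OPT_le:
  assumes "finite (verts I)" "path_between (verts I) (edges I - X) (source I) (dest I) p"
  shows "OPT I X \<le> walk_cost (cost I) p"
  unfolding OPT_def using assms finite_paths[OF assms(1)] by (intro Min_le) auto

lemma OPT_mono:
  assumes "finite (verts I)" "X \<subseteq> Y" "feasible I Y"
  shows "OPT I X \<le> OPT I Y"
proof -
  have "path_between (verts I) (edges I - X) (source I) (dest I) (shortest_path I Y)"
    using shortest_path(1)[OF assms(1,3)] path_between_mono assms(2) by (metis Diff_mono order_refl)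
  then show ?thesis using OPT_le[OF assms(1)] shortest_path(2)[OF assms(1,3)] by force
qed

lemma OPT_nonneg:
  assumes "finite (verts I)" "\<And>e. e \<in> edges I \<Longrightarrow> 0 \<le> cost I e" "feasible I X"
  shows "0 \<le> OPT I X"
proof -
  have "set (walk_edges (shortest_path I X)) \<subseteq> edges I"
    using shortest_path(1)[OF assms(1,3)] by (auto simp: path_between_def walk_between_def)
  then show ?thesis
    unfolding shortest_path(2)[OF assms(1,3), symmetric] walk_cost_def
    by (intro sum_list_nonneg) (use assms(2) in auto)
qed

theorem theorem12:
  "\<exists>A :: 'v ctp_strategy. ctp_algorithm 2 A \<and>
     (\<forall>I B. ctp_instance 2 I B \<and> prediction_error I B \<le> 1 \<longrightarrow>
        ALG A I B \<le> (3 + sqrt 17) / 2 * OPT I B)"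
proof -
  let ?r = "(3 + sqrt 17) / 2"
  have fin: "finite (verts I) \<and> (\<forall>X \<subseteq> edges I. finite X) \<and> (\<forall>e\<in>edges I. 0 \<le> cost I e) \<and>
      feasible I B \<and> B \<subseteq> edges I \<and> card B \<le> 2 \<and> predicted I \<subseteq> edges I \<and>
      card (predicted I) \<le> 2 \<and> source I \<in> verts I"
    if "ctp_instance 2 I B" for I :: "'v ctp_input" and B
  proof -
    have "finite (verts I)" "edges I \<subseteq> Pow (verts I)"
      using that by (auto simp: ctp_instance_def simple_graph_def)
    then have "finite (edges I)" by (meson finite_Pow_iff finite_subset)
    then show ?thesis using that \<open>finite (verts I)\<close>
      by (auto simp: ctp_instance_def feasible_def intro: finite_subset)
  qed
  \<comment> \<open>The plan is chosen from \<open>I\<close> alone. The hidden set \<open>B\<close>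
    enters only the proof that a plan exists, so the resulting strategy is online and
    deterministic.\<close>
  define \<sigma> where
    "\<sigma> I = (SOME \<sigma>. competitive_plan ?r (OPT I) (feasible I) (predicted I) \<sigma>)" for I :: "'v ctp_input"
  have \<sigma>: "competitive_plan ?r (OPT I) (feasible I) (predicted I) (\<sigma> I)"
    if "ctp_instance 2 I B" for I B
  proof -
    note f = fin[OF that]
    have "\<exists>\<sigma>. competitive_plan ?r (OPT I) (feasible I) (predicted I) \<sigma>"
    proof (rule competitive_plan_exists)
      show "feasible I X" if "X \<subseteq> Y" "feasible I Y" for X Y
        using feasible_antimono that by blast
      show "0 \<le> OPT I X" if "feasible I X" for X using OPT_nonneg f that by blast
      show "OPT I X \<le> OPT I Y" if "X \<subseteq> Y" "feasible I Y" for X Y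
        using OPT_mono f that by blast
    qed (use f ratio_root in auto)
    then show ?thesis unfolding \<sigma>_def by (rule someI_ex)
  qed
  define \<pi> where "\<pi> I K = shortest_path I (\<sigma> I K)" for I :: "'v ctp_input" and K
  define A :: "'v ctp_strategy" where "A I h = follow (\<pi> I) (source I) h" for I h
  \<comment> \<open>One route serves both claims: its existence is correctness for any prediction
    error, and its \<open>trip\<close> bound gives the ratio when the error is at most
    \<open>1\<close>.\<close>
  have route: "\<exists>q K C. ctp_route A I B q \<and> K \<subseteq> B \<and> trip (OPT I) (\<sigma> I) B K C \<and>
      walk_cost (cost I) q \<le> C" if inst: "ctp_instance 2 I B" for I B
  proof -
    note f = fin[OF inst]
    have plan: "K \<subseteq> \<sigma> I K \<and> feasible I (\<sigma> I K)" if "K \<subseteq> B" for K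
      using competitive_planD(1,2)[OF \<sigma>[OF inst]] feasible_antimono[OF that] f by simp
    have path: "path_between (verts I) (edges I - \<sigma> I K) (source I) (dest I) (\<pi> I K)"
      "walk_cost (cost I) (\<pi> I K) = OPT I (\<sigma> I K)" if "K \<subseteq> B" for K
      using shortest_path[of I "\<sigma> I K"] f plan[OF that] unfolding \<pi>_def by simp_all
    \<comment> \<open>The construction starts from the one-vertex walk, which costs nothing but
      already reveals the blocked edges at the source.\<close>
    have p: "route_prefix A I B [source I]" using f by (simp add: route_prefix_def)
    have "\<exists>q C. ctp_route A I B q \<and> trip (OPT I) (\<sigma> I) B (known (observed B [source I])) C \<and>
        walk_cost (cost I) q \<le> walk_cost (cost I) [source I] + C"
    proof (rule route_exists[where \<pi> = "\<pi> I"])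
      fix K assume K: "K \<subseteq> B"
      show "path_between (verts I) (edges I - K) (source I) (dest I) (\<pi> I K)"
        using path_between_mono[OF path(1)[OF K]] plan[OF K] by blast
      show "set (walk_edges (\<pi> I K)) \<inter> \<sigma> I K = {}"
        using path(1)[OF K] unfolding path_between_def walk_between_def by blast
    qed (use A_def f path p in auto)
    moreover have "walk_cost (cost I) [source I] = 0" by (simp add: walk_cost_def)
    ultimately show ?thesis using known_observed_subset by (metis add_0)
  qed
  have "ALG A I B \<le> ?r * OPT I B"
    if inst: "ctp_instance 2 I B" and err: "prediction_error I B \<le> 1" for I B
  proof -
    obtain q K C where q: "ctp_route A I B q" "K \<subseteq> B" "trip (OPT I) (\<sigma> I) B K C"
      "walk_cost (cost I) q \<le> C" using route[OF inst] by blast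
    have "ALG A I B = walk_cost (cost I) q"
      unfolding ALG_def using q(1) ctp_route_unique by (metis the_equality)
    moreover have "C \<le> ?r * OPT I B"
      by (rule competitive_planD(3)[OF \<sigma>[OF inst]])
        (use fin[OF inst] err q in \<open>auto simp: prediction_error_def\<close>)
    ultimately show ?thesis using q(4) by simp
  qed
  then show ?thesis using route unfolding ctp_algorithm_def by blast
qed

end
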